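(* Let $c\ge 2$ and let $k_1,\dots,k_c\ge 2$ be integers. For two colours ($c=2$, writing $k=k_1$, $l=k_2$), \[\operatorname{osat}_{\mathcal G}(k,l)=\operatorname{sat}_{\mathcal G}(k,l)=(k-1)(l-1),\] and for $c\ge 3$ colours, \[(k_1-1)(k_2+\dots+k_c-2c+3)\le \operatorname{osat}_{\mathcal G}(k_1,\ldots,k_c)\le \operatorname{sat}_{\mathcal G}(k_1,\ldots,k_c)\le (k_1-1)\cdots(k_c-1).\] Moreover, in the lower bound $k_1$ may be exchanged with any other $k_j$: for every $j\in[c]$, \[(k_j-1)\Big(\sum_{i\ne j}k_i-2c+3\Big)\le \operatorname{osat}_{\mathcal G}(k_1,\ldots,k_c).\]
   Context: Let $\mathcal G$ be the family of finite complete graphs whose edges are each coloured with one of $c$ colours $1,\dots,c$. For $G,G'\in\mathcal G$, $G'$ extends $G$ if $G$ is a proper subgraph of $G'$ with the same edge colours, i.e. $G'$ is obtained from $G$ by adding new vertices and coloured edges from them to all other vertices. A graph $G\in\mathcal G$ is $(k_1,\dots,k_c)$-saturated if for every $i$ it contains no monochromatic $K_{k_i}$ of colour $i$, but every $G'\in\mathcal G$ extending $G$ contains a monochromatic $K_{k_i}$ of colour $i$ for some $i$. It is $(k_1,\dots,k_c)$-semisaturated if every $G'\in\mathcal G$ extending $G$ contains, for some $i$, a monochromatic $K_{k_i}$ of colour $i$ that is not contained in $G$. $\operatorname{sat}_{\mathcal G}(k_1,\dots,k_c)$ (resp. $\operatorname{osat}_{\mathcal G}(k_1,\dots,k_c)$)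 is the minimum number of vertices of a $(k_1,\dots,k_c)$-saturated (resp. semisaturated) member of $\mathcal G$. *)

theory Defs
  imports Complex_Main "HOL-Library.Ramsey" "HOL-Library.FuncSet"
begin

text \<open>An edge-coloured finite complete graph is a pair of a finite vertex set and a function on
  vertex sets, of which only the values on the 2-element subsets of the vertex set (the edges)
  matter. Every such graph is isomorphic to one with vertices in \<^typ>\<open>nat\<close>, and as \<^typ>\<open>nat\<close> is
  infinite there is always room for extensions.\<close>

type_synonym cgraph = "nat set \<times> (nat set \<Rightarrow> nat)"

abbreviation verts :: "cgraph \<Rightarrow> nat set" where
  "verts \<equiv> fst"

abbreviation edges :: "cgraph \<Rightarrow> nat set set" where
  "edges G \<equiv> nsets (verts G) 2"

abbreviation colour :: "cgraph \<Rightarrow> nat set \<Rightarrow> nat" where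
  "colour \<equiv> snd"

definition coloured_complete_graphs :: "nat \<Rightarrow> cgraph set" where
  "coloured_complete_graphs c = {G. finite (verts G) \<and> colour G \<in> edges G \<rightarrow> {1..c}}"

definition extends :: "cgraph \<Rightarrow> cgraph \<Rightarrow> bool" where
  "extends G' G \<longleftrightarrow> verts G \<subset> verts G' \<and> (\<forall>e \<in> edges G. colour G' e = colour G e)"

text \<open>The vertex sets of the monochromatic complete subgraphs on \<open>m\<close> vertices of colour \<open>i\<close>.\<close>

definition mono_cliques :: "cgraph \<Rightarrow> nat \<Rightarrow> nat \<Rightarrow> nat set set" where
  "mono_cliques G m i = {S \<in> nsets (verts G) m. \<forall>e \<in> nsets S 2. colour G e = i}"

definition saturated :: "nat \<Rightarrow> (nat \<Rightarrow> nat) \<Rightarrow> cgraph \<Rightarrow> bool" where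
  "saturated c k G \<longleftrightarrow> G \<in> coloured_complete_graphs c \<and>
     (\<forall>i \<in> {1..c}. mono_cliques G (k i) i = {}) \<and>
     (\<forall>G' \<in> coloured_complete_graphs c. extends G' G \<longrightarrow>
        (\<exists>i \<in> {1..c}. mono_cliques G' (k i) i \<noteq> {}))"

definition semisaturated :: "nat \<Rightarrow> (nat \<Rightarrow> nat) \<Rightarrow> cgraph \<Rightarrow> bool" where
  "semisaturated c k G \<longleftrightarrow> G \<in> coloured_complete_graphs c \<and>
     (\<forall>G' \<in> coloured_complete_graphs c. extends G' G \<longrightarrow>
        (\<exists>i \<in> {1..c}. \<exists>S \<in> mono_cliques G' (k i) i. \<not> S \<subseteq> verts G))"

text \<open>On \<^typ>\<open>nat\<close>, the infimum of a nonempty set is its minimum, and the infimum of the empty set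
  is 0. A positive value therefore certifies that the minimum is attained. If \<open>k i \<ge> 2\<close> for all
  \<open>i\<close>, the empty graph is neither saturated nor semisaturated, so admitting it has no effect.\<close>

definition sat :: "nat \<Rightarrow> (nat \<Rightarrow> nat) \<Rightarrow> nat" where
  "sat c k = Inf {card (verts G) | G. saturated c k G}"

definition osat :: "nat \<Rightarrow> (nat \<Rightarrow> nat) \<Rightarrow> nat" where
  "osat c k = Inf {card (verts G) | G. semisaturated c k G}"

end

theory Submission
  imports Defs "HOL-Library.Nat_Bijection"
begin

text \<open>Write \<open>a i = k i - 1\<close>. Looking at one new vertex, \<open>G\<close> is semisaturated iff for every vertex
  colouring some colour class \<open>i\<close> contains a clique of colour \<open>i\<close> on \<open>a i\<close> vertices.

  For the lower bound, suppose \<open>G\<close> has fewer than \<open>a j * (1 + (\<Sum>i\<noteq>j. a i - 1))\<close> vertices. If \<open>G\<close>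
  has no clique of colour \<open>j\<close> on \<open>a j\<close> vertices, give all vertices the colour \<open>j\<close>. Otherwise give
  such a clique a colour \<open>i \<noteq> j\<close> with \<open>a i > 1\<close>: a clique of colour \<open>i\<close> meets it in at most one
  vertex, so we may delete it and decrease \<open>a i\<close> by one.

  For the upper bound, take the lexicographic product of monochromatic cliques of colour \<open>i\<close>
  on \<open>a i\<close> vertices.\<close>

text \<open>The map \<open>f\<close> stands for the colours of the edges from one new vertex to
  \<open>verts G\<close>. The palette \<open>I\<close> is a parameter because the upper bound goes
  by induction on the set of colours.\<close>

definition arrows :: "nat set \<Rightarrow> (nat \<Rightarrow> nat) \<Rightarrow> cgraph \<Rightarrow> bool" where
  "arrows I a G \<longleftrightarrow>
     (\<forall>f \<in> verts G \<rightarrow> I. \<exists>i\<in>I. \<exists>S \<in> mono_cliques G (a i) i. \<forall>x\<in>S. f x = i)"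

lemma mono_cliques_iff:
  "S \<in> mono_cliques G m i \<longleftrightarrow> S \<subseteq> verts G \<and> finite S \<and> card S = m \<and>
     (\<forall>x\<in>S. \<forall>y\<in>S. x \<noteq> y \<longrightarrow> colour G {x, y} = i)"
proof -
  have "(\<forall>e \<in> nsets S 2. colour G e = i) \<longleftrightarrow>
      (\<forall>x\<in>S. \<forall>y\<in>S. x \<noteq> y \<longrightarrow> colour G {x, y} = i)"
    by (auto simp: nsets_2_eq)
  then show ?thesis by (simp add: mono_cliques_def nsets_def[of "verts G" m] conj_assoc)
qed

lemma in_nsets_2_iff: "e \<in> nsets A 2 \<longleftrightarrow> (\<exists>x\<in>A. \<exists>y\<in>A. x \<noteq> y \<and> e = {x, y})"
  unfolding nsets_2_eq by blast

subsection \<open>Lower bound\<close>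

text \<open>Induction on the sum. Lowering one \<open>a i\<close> with \<open>i \<in> J\<close> by
  one lowers the bound by exactly \<open>a j\<close>, which is the number of vertices of the deleted
  clique, so the strict inequality survives.\<close>

lemma not_arrows_small:
  assumes "finite J" "j \<notin> J" "\<forall>i\<in>J. 1 \<le> a i" "finite V"
    and "card V < a j * (1 + (\<Sum>i\<in>J. a i - 1))"
  shows "\<not> arrows (insert j J) a (V, col)"
  using assms(3-5)
proof (induction "\<Sum>i\<in>J. a i - 1" arbitrary: a V rule: less_induct)
  case less
  show ?case
  proof (cases "mono_cliques (V, col) (a j) j = {}")
    case True
    have "\<not> (\<exists>i\<in>insert j J. \<exists>S \<in> mono_cliques (V, col) (a i) i. \<forall>x\<in>S. j = i)"
    proof
      assume "\<exists>i\<in>insert j J. \<exists>S \<in> mono_cliques (V, col) (a i) i. \<forall>x\<in>S. j = i"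
      then obtain i S where i: "i \<in> insert j J" "S \<in> mono_cliques (V, col) (a i) i"
        "\<forall>x\<in>S. j = i" by blast
      with True have "i \<in> J" "i \<noteq> j" using \<open>j \<notin> J\<close> by auto
      \<comment> \<open>A vertex of \<open>S\<close> would force \<open>j = i\<close>, and an empty
        clique contradicts \<open>1 \<le> a i\<close>.\<close>
      moreover have "S = {}" using i \<open>i \<noteq> j\<close> by auto
      ultimately show False using i(2) less.prems(1) by (auto simp: mono_cliques_iff)
    qed
    then show ?thesis unfolding arrows_def by (auto intro!: bexI[of _ "\<lambda>_. j"])
  next
    case False
    then obtain S where "S \<in> mono_cliques (V, col) (a j) j" by blast
    then have S: "S \<subseteq> V" "finite S" "card S = a j"
      "\<And>x y. \<lbrakk>x \<in> S; y \<in> S; x \<noteq> y\<rbrakk> \<Longrightarrow> col {x, y} = j"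
      by (auto simp: mono_cliques_iff)
    have "a j \<le> card V" using S less.prems(2) card_mono by metis
    \<comment> \<open>If the sum were zero, the bound would read \<open>card V < a j\<close>,
      leaving no room for \<open>S\<close>.\<close>
    then have "(\<Sum>i\<in>J. a i - 1) \<noteq> 0" using less.prems(3) by (intro notI) simp
    then obtain i where i: "i \<in> J" "a i - 1 \<noteq> 0" using sum.neutral by meson
    define b where "b = a(i := a i - 1)"
    have "(\<Sum>l\<in>J - {i}. b l - 1) = (\<Sum>l\<in>J - {i}. a l - 1)"
      by (rule sum.cong) (auto simp: b_def)
    then have sums: "(\<Sum>l\<in>J. a l - 1) = Suc (\<Sum>l\<in>J. b l - 1)"
      using i by (simp add: sum.remove[OF \<open>finite J\<close> i(1)] b_def)
    have bj: "b j = a j" using i \<open>j \<notin> J\<close> by (auto simp: b_def)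
    have "card (V - S) < b j * (1 + (\<Sum>l\<in>J. b l - 1))"
      using less.prems(3) S \<open>a j \<le> card V\<close> unfolding sums bj
      by (simp add: card_Diff_subset)
    then have "\<not> arrows (insert j J) b (V - S, col)"
      using less.hyps[of b "V - S"] sums less.prems(1,2) i by (auto simp: b_def)
    then have "\<exists>f \<in> V - S \<rightarrow> insert j J. \<not> (\<exists>l\<in>insert j J. \<exists>T \<in> mono_cliques (V - S, col) (b l) l. \<forall>x\<in>T. f x = l)"
      by (simp add: arrows_def)
    then obtain f where f: "f \<in> V - S \<rightarrow> insert j J"
      "\<not> (\<exists>l\<in>insert j J. \<exists>T \<in> mono_cliques (V - S, col) (b l) l. \<forall>x\<in>T. f x = l)"
      by (rule bexE)
    define g where "g x = (if x \<in> S then i else f x)" for x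
    have "\<exists>x\<in>T. g x \<noteq> l" if l: "l \<in> insert j J" and T: "T \<in> mono_cliques (V, col) (a l) l" for l T
    proof (rule ccontr)
      assume "\<not> ?thesis"
      then have gT: "\<And>x. x \<in> T \<Longrightarrow> g x = l" by auto
      \<comment> \<open>A subset is taken because for \<open>l = i\<close> the clique
        \<open>T\<close> may miss \<open>S\<close>, and then \<open>T - S\<close> has one vertex
        more than \<open>b l\<close>.\<close>
      have "\<exists>U. U \<subseteq> T - S \<and> finite U \<and> card U = b l"
      proof (cases "l = i")
        case True
        \<comment> \<open>An edge inside \<open>T \<inter> S\<close> would have both colours
          \<open>i\<close> and \<open>j\<close>.\<close>
        have "x = y" if "x \<in> T \<inter> S" "y \<in> T \<inter> S" for x y
          using that S(4)[of x y] T True i \<open>j \<notin> J\<close> by (auto simp: mono_cliques_iff)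
        then have "card (T \<inter> S) \<le> 1"
          by (metis One_nat_def S(2) card_le_Suc0_iff_eq finite_Int)
        moreover have "card (T - S) = card T - card (T \<inter> S)"
          using T by (simp add: card_Diff_subset_Int mono_cliques_iff)
        ultimately have "b l \<le> card (T - S)"
          using T True by (auto simp: mono_cliques_iff b_def)
        then show ?thesis by (meson obtain_subset_with_card_n)
      next
        case False
        \<comment> \<open>All of \<open>S\<close> has colour \<open>i\<close> under
          \<open>g\<close>, so a clique in another class avoids \<open>S\<close>.\<close>
        then have "T - S = T" using gT by (force simp: g_def)
        then show ?thesis using T False by (auto simp: mono_cliques_iff b_def)
      qed
      then obtain U where U: "U \<subseteq> T - S" "finite U" "card U = b l" by blast
      have "U \<in> mono_cliques (V - S, col) (b l) l"
        using U T by (auto simp: mono_cliques_iff)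
      then obtain x where "x \<in> U" "f x \<noteq> l" using f(2) l by blast
      then show False using U(1) gT[of x] by (auto simp: g_def)
    qed
    moreover have "g \<in> V \<rightarrow> insert j J" using f(1) i(1) by (fastforce simp: g_def)
    ultimately show ?thesis unfolding arrows_def by (metis fst_conv)
  qed
qed

text \<open>A vertex colouring \<open>f\<close> describes an extension by one vertex
  \<open>v\<close>, with \<open>f x\<close> as the colour of the edge from \<open>v\<close> to
  \<open>x\<close>. A new clique must contain \<open>v\<close>, and removing \<open>v\<close> leaves
  the required clique.\<close>

lemma semisaturated_imp_arrows:
  assumes "semisaturated c k G" "\<forall>i\<in>{1..c}. 1 \<le> k i"
  shows "arrows {1..c} (\<lambda>i. k i - 1) G"
  unfolding arrows_def
proof
  fix f assume f: "f \<in> verts G \<rightarrow> {1..c}"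
  have G: "finite (verts G)" "colour G \<in> edges G \<rightarrow> {1..c}"
    using assms by (auto simp: semisaturated_def coloured_complete_graphs_def)
  obtain v where v: "v \<notin> verts G" using G(1) ex_new_if_finite by blast
  \<comment> \<open>For an edge \<open>e\<close> through \<open>v\<close>,
    \<open>the_elem (e - {v})\<close> is its other endpoint.\<close>
  define col where "col e = (if v \<in> e then f (the_elem (e - {v})) else colour G e)" for e
  have colv: "col {v, x} = f x" "col {x, v} = f x" if "x \<noteq> v" for x
  proof -
    have "{v, x} - {v} = {x}" "{x, v} - {v} = {x}" using that by auto
    then show "col {v, x} = f x" "col {x, v} = f x" by (auto simp: col_def)
  qed
  define G' where "G' = (insert v (verts G), col)"
  have old: "col e = colour G e" if "e \<in> edges G" for e
    using that v by (auto simp: col_def nsets_def)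
  have "col e \<in> {1..c}" if e: "e \<in> edges G'" for e
  proof -
    obtain x y where xy: "x \<in> insert v (verts G)" "y \<in> insert v (verts G)" "x \<noteq> y" "e = {x, y}"
      using e unfolding in_nsets_2_iff G'_def by auto
    show ?thesis
    proof (cases "v \<in> e")
      case True
      then show ?thesis using xy f colv by fastforce
    next
      case False
      then have "e \<in> edges G" using xy by (auto simp: in_nsets_2_iff)
      then show ?thesis using old G(2) by auto
    qed
  qed
  then have "G' \<in> coloured_complete_graphs c" "extends G' G"
    using G(1) v old by (auto simp: coloured_complete_graphs_def extends_def G'_def)
  then obtain i S where i: "i \<in> {1..c}" and S: "S \<in> mono_cliques G' (k i) i" "\<not> S \<subseteq> verts G"
    using assms(1) unfolding semisaturated_def by blast
  then have SG: "S \<subseteq> insert v (verts G)" "finite S" "card S = k i"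
    "\<And>x y. \<lbrakk>x \<in> S; y \<in> S; x \<noteq> y\<rbrakk> \<Longrightarrow> col {x, y} = i" and vS: "v \<in> S"
    by (auto simp: mono_cliques_iff G'_def)
  have "S - {v} \<in> mono_cliques G (k i - 1) i"
    unfolding mono_cliques_iff
  proof (intro conjI ballI impI)
    show "S - {v} \<subseteq> verts G" "finite (S - {v})" "card (S - {v}) = k i - 1"
      using SG vS by auto
    fix x y assume xy: "x \<in> S - {v}" "y \<in> S - {v}" "x \<noteq> y"
    then have "{x, y} \<in> edges G" using SG(1) by (auto simp: in_nsets_2_iff)
    then show "colour G {x, y} = i" using old[of "{x, y}"] SG(4)[of x y] xy by auto
  qed
  moreover have "\<forall>x\<in>S - {v}. f x = i" using SG(4)[OF vS] colv by fastforce
  ultimately show "\<exists>i\<in>{1..c}. \<exists>S\<in>mono_cliques G (k i - 1) i. \<forall>x\<in>S. f x = i"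
    using i by blast
qed

lemma semisaturated_card_ge:
  assumes "semisaturated c k G" "\<forall>i\<in>{1..c}. 2 \<le> k i" "j \<in> {1..c}"
  shows "(k j - 1) * (1 + (\<Sum>i\<in>{1..c} - {j}. k i - 2)) \<le> card (verts G)"
proof (rule ccontr)
  assume small: "\<not> ?thesis"
  have "finite (verts G)"
    using assms(1) by (simp add: semisaturated_def coloured_complete_graphs_def)
  moreover have "\<forall>i\<in>{1..c} - {j}. 1 \<le> k i - 1" using assms(2) by force
  moreover have "k i - 1 - 1 = k i - 2" for i by simp
  ultimately have "\<not> arrows (insert j ({1..c} - {j})) (\<lambda>i. k i - 1) (verts G, colour G)"
    using small by (intro not_arrows_small) auto
  moreover have "arrows {1..c} (\<lambda>i. k i - 1) G"
    using semisaturated_imp_arrows[OF assms(1)] assms(2) by force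
  ultimately show False using assms(3) by (simp add: insert_absorb)
qed

subsection \<open>Upper bound\<close>

text \<open>Extensions keep the old colours, so a clique of \<open>G'\<close> within
  \<open>verts G\<close> would already be a forbidden clique of \<open>G\<close>.\<close>

lemma saturated_imp_semisaturated:
  assumes "saturated c k G"
  shows "semisaturated c k G"
  unfolding semisaturated_def
proof (intro conjI ballI impI)
  show "G \<in> coloured_complete_graphs c" using assms by (simp add: saturated_def)
  fix G' assume G': "G' \<in> coloured_complete_graphs c" "extends G' G"
  then obtain i S where i: "i \<in> {1..c}" "S \<in> mono_cliques G' (k i) i"
    using assms unfolding saturated_def by blast
  have "\<not> S \<subseteq> verts G"
  proof
    assume "S \<subseteq> verts G"
    then have "colour G {x, y} = colour G' {x, y}" if "x \<in> S" "y \<in> S" "x \<noteq> y" for x y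
      using that G'(2) by (simp add: extends_def subsetD)
    then have "S \<in> mono_cliques G (k i) i"
      using i(2) \<open>S \<subseteq> verts G\<close> by (simp add: mono_cliques_iff)
    then show False using assms i(1) by (auto simp: saturated_def)
  qed
  then show "\<exists>i\<in>{1..c}. \<exists>S\<in>mono_cliques G' (k i) i. \<not> S \<subseteq> verts G"
    using i by blast
qed

text \<open>However many vertices \<open>G'\<close> adds, one new vertex \<open>v\<close> suffices:
  the colours of its edges to \<open>verts G\<close> form a vertex colouring, and the clique found
  there is completed by \<open>v\<close>.\<close>

lemma arrows_imp_saturated:
  assumes G: "G \<in> coloured_complete_graphs c" and k: "\<forall>i\<in>{1..c}. 1 \<le> k i"
    and free: "\<forall>i\<in>{1..c}. mono_cliques G (k i) i = {}"
    and arr: "arrows {1..c} (\<lambda>i. k i - 1) G"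
  shows "saturated c k G"
  unfolding saturated_def
proof (intro conjI ballI impI)
  show "G \<in> coloured_complete_graphs c" by fact
  show "mono_cliques G (k i) i = {}" if "i \<in> {1..c}" for i using free that by blast
  fix G' assume G': "G' \<in> coloured_complete_graphs c" "extends G' G"
  then obtain v where v: "v \<in> verts G'" "v \<notin> verts G" and sub: "verts G \<subseteq> verts G'"
    by (auto simp: extends_def)
  have "(\<lambda>x. colour G' {v, x}) \<in> verts G \<rightarrow> {1..c}"
  proof
    fix x assume "x \<in> verts G"
    then have "{v, x} \<in> edges G'" using v sub by auto
    then show "colour G' {v, x} \<in> {1..c}"
      using G'(1) by (auto simp: coloured_complete_graphs_def)
  qed
  then have "\<exists>i\<in>{1..c}. \<exists>S \<in> mono_cliques G (k i - 1) i. \<forall>x\<in>S. colour G' {v, x} = i"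
    using arr unfolding arrows_def by (rule bspec[rotated])
  then obtain i S where i: "i \<in> {1..c}" and S: "S \<in> mono_cliques G (k i - 1) i"
    "\<forall>x\<in>S. colour G' {v, x} = i" by blast
  have old: "colour G' {x, y} = i" if "x \<in> S" "y \<in> S" "x \<noteq> y" for x y
  proof -
    have "{x, y} \<in> edges G" using that S(1) by (auto simp: in_nsets_2_iff mono_cliques_iff)
    then have "colour G' {x, y} = colour G {x, y}" using G'(2) by (simp add: extends_def)
    then show ?thesis using that S(1) by (simp add: mono_cliques_iff)
  qed
  have "v \<notin> S" "finite S" "card S = k i - 1" "S \<subseteq> verts G"
    using S(1) v by (auto simp: mono_cliques_iff)
  moreover have "Suc (k i - 1) = k i" using bspec[OF k i] by simp
  ultimately have "insert v S \<in> mono_cliques G' (k i) i"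
    using v sub old S(2) by (auto simp: mono_cliques_iff insert_commute)
  then show "\<exists>i\<in>{1..c}. mono_cliques G' (k i) i \<noteq> {}" using i by blast
qed

text \<open>The lexicographic product of a clique of colour \<open>j\<close> on \<open>m\<close> vertices with \<open>G\<close>: the vertex
  coding \<open>(t, v)\<close> lies in block \<open>t\<close>, and an edge lies within a block iff its set of block numbers
  is a singleton.\<close>

definition lex_blow_up :: "nat \<Rightarrow> nat \<Rightarrow> cgraph \<Rightarrow> cgraph" where
  "lex_blow_up j m G = (prod_encode ` ({..<m} \<times> verts G),
     \<lambda>e. if is_singleton ((fst \<circ> prod_decode) ` e) then colour G ((snd \<circ> prod_decode) ` e) else j)"

lemma verts_lex_blow_up: "verts (lex_blow_up j m G) = prod_encode ` ({..<m} \<times> verts G)"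
  by (simp add: lex_blow_up_def)

lemma verts_lex_blow_upE:
  assumes "x \<in> verts (lex_blow_up j m G)"
  obtains t u where "x = prod_encode (t, u)" "t < m" "u \<in> verts G"
  using assms by (auto simp: verts_lex_blow_up)

lemma colour_lex_blow_up:
  "colour (lex_blow_up j m G) {prod_encode (s, u), prod_encode (t, v)} =
     (if s = t then colour G {u, v} else j)"
proof -
  have "is_singleton {s, t} \<longleftrightarrow> s = t" by (auto simp: is_singleton_def doubleton_eq_iff)
  then show ?thesis by (simp add: lex_blow_up_def)
qed

lemma card_verts_lex_blow_up: "card (verts (lex_blow_up j m G)) = m * card (verts G)"
  by (simp add: verts_lex_blow_up card_image inj_prod_encode card_cartesian_product)

lemma colour_lex_blow_up_in:
  assumes "colour G \<in> edges G \<rightarrow> J"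
  shows "colour (lex_blow_up j m G) \<in> edges (lex_blow_up j m G) \<rightarrow> insert j J"
proof
  fix e assume "e \<in> edges (lex_blow_up j m G)"
  then obtain x y where "x \<in> verts (lex_blow_up j m G)" "y \<in> verts (lex_blow_up j m G)"
    "x \<noteq> y" "e = {x, y}" unfolding in_nsets_2_iff by blast
  then obtain s u t v where e: "e = {prod_encode (s, u), prod_encode (t, v)}"
    "u \<in> verts G" "v \<in> verts G" "(s, u) \<noteq> (t, v)" by (metis verts_lex_blow_upE)
  have "colour G {u, v} \<in> J" if "s = t"
  proof -
    have "{u, v} \<in> edges G" using e that by (auto simp: in_nsets_2_iff)
    then show ?thesis using assms by auto
  qed
  then show "colour (lex_blow_up j m G) e \<in> insert j J"
    by (simp add: e(1) colour_lex_blow_up)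
qed

text \<open>Edges within a block have colours from \<open>J\<close>, so a clique of colour
  \<open>j\<close> has at most one vertex in each of the \<open>m\<close> blocks.\<close>

lemma mono_cliques_lex_blow_up_outer:
  assumes "colour G \<in> edges G \<rightarrow> J" "j \<notin> J" "m < n"
  shows "mono_cliques (lex_blow_up j m G) n j = {}"
proof (rule equals0I)
  fix S assume S: "S \<in> mono_cliques (lex_blow_up j m G) n j"
  have "inj_on (fst \<circ> prod_decode) S"
  proof (rule inj_onI, rule ccontr)
    fix x y assume xy: "x \<in> S" "y \<in> S" "(fst \<circ> prod_decode) x = (fst \<circ> prod_decode) y" "x \<noteq> y"
    then have "x \<in> verts (lex_blow_up j m G)" "y \<in> verts (lex_blow_up j m G)"
      using S by (auto simp: mono_cliques_iff)
    then obtain s u t v where "x = prod_encode (s, u)" "y = prod_encode (t, v)"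
      "u \<in> verts G" "v \<in> verts G" by (metis verts_lex_blow_upE)
    then have uv: "x = prod_encode (t, u)" "y = prod_encode (t, v)" "u \<in> verts G" "v \<in> verts G"
      using xy(3) by auto
    then have "{u, v} \<in> edges G" using xy(4) by (auto simp: in_nsets_2_iff)
    moreover have "colour G {u, v} = j"
      using S xy uv colour_lex_blow_up[of j m G t u t v] by (simp add: mono_cliques_iff)
    ultimately show False using assms(1,2) by auto
  qed
  moreover have "(fst \<circ> prod_decode) ` S \<subseteq> {..<m}"
    using S by (auto simp: mono_cliques_iff verts_lex_blow_up)
  ultimately have "card S \<le> card {..<m}" by (rule card_inj_on_le) simp
  then show False using S assms(3) by (simp add: mono_cliques_iff)
qed

text \<open>Edges between blocks have colour \<open>j\<close>, so a clique of colour
  \<open>i \<noteq> j\<close> lies in a single block and projects injectively onto a clique of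
  \<open>G\<close>.\<close>

lemma mono_cliques_lex_blow_up_inner:
  assumes "mono_cliques G n i = {}" "i \<noteq> j"
  shows "mono_cliques (lex_blow_up j m G) n i = {}"
proof (rule equals0I)
  fix S assume S: "S \<in> mono_cliques (lex_blow_up j m G) n i"
  have mem: "\<exists>t u. x = prod_encode (t, u) \<and> u \<in> verts G" if "x \<in> S" for x
    using S that by (meson mono_cliques_iff subsetD verts_lex_blow_upE)
  have edge: "s = t \<and> colour G {u, v} = i"
    if "prod_encode (s, u) \<in> S" "prod_encode (t, v) \<in> S" "(s, u) \<noteq> (t, v)" for s t u v
  proof -
    have "colour (lex_blow_up j m G) {prod_encode (s, u), prod_encode (t, v)} = i"
      using S that by (simp add: mono_cliques_iff)
    then show ?thesis using assms(2) by (auto simp: colour_lex_blow_up split: if_splits)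
  qed
  have inj: "inj_on (snd \<circ> prod_decode) S"
  proof (rule inj_onI)
    fix x y assume xy: "x \<in> S" "y \<in> S" "(snd \<circ> prod_decode) x = (snd \<circ> prod_decode) y"
    obtain s u t v where "x = prod_encode (s, u)" "y = prod_encode (t, v)"
      using mem[OF xy(1)] mem[OF xy(2)] by blast
    then show "x = y" using edge[of s u t v] xy by auto
  qed
  have "(snd \<circ> prod_decode) ` S \<in> mono_cliques G n i"
    unfolding mono_cliques_iff
  proof (intro conjI ballI impI)
    show "(snd \<circ> prod_decode) ` S \<subseteq> verts G" using mem by force
    show "finite ((snd \<circ> prod_decode) ` S)" using S by (simp add: mono_cliques_iff)
    show "card ((snd \<circ> prod_decode) ` S) = n"
      using S card_image[OF inj] by (simp add: mono_cliques_iff)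
    fix u v assume "u \<in> (snd \<circ> prod_decode) ` S" "v \<in> (snd \<circ> prod_decode) ` S" "u \<noteq> v"
    then obtain s t where "prod_encode (s, u) \<in> S" "prod_encode (t, v) \<in> S"
      using mem by force
    then show "colour G {u, v} = i" using edge \<open>u \<noteq> v\<close> by blast
  qed
  then show False using assms(1) by blast
qed

text \<open>Either every block has a vertex of class \<open>j\<close>, and one such vertex per block
  gives a clique of colour \<open>j\<close>, or some block avoids class \<open>j\<close>, and the
  hypothesis applies to its copy of \<open>G\<close>.\<close>

lemma arrows_lex_blow_up:
  assumes "arrows J a G" "j \<notin> J"
  shows "arrows (insert j J) a (lex_blow_up j (a j) G)"
  unfolding arrows_def
proof
  fix f assume f: "f \<in> verts (lex_blow_up j (a j) G) \<rightarrow> insert j J"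
  show "\<exists>i\<in>insert j J. \<exists>S \<in> mono_cliques (lex_blow_up j (a j) G) (a i) i. \<forall>x\<in>S. f x = i"
  proof (cases "\<forall>t<a j. \<exists>v\<in>verts G. f (prod_encode (t, v)) = j")
    case True
    then obtain v where v: "\<And>t. t < a j \<Longrightarrow> v t \<in> verts G \<and> f (prod_encode (t, v t)) = j"
      by metis
    let ?S = "(\<lambda>t. prod_encode (t, v t)) ` {..<a j}"
    have "inj_on (\<lambda>t. prod_encode (t, v t)) {..<a j}" by (auto simp: inj_on_def)
    then have "?S \<in> mono_cliques (lex_blow_up j (a j) G) (a j) j"
      using v by (auto simp: mono_cliques_iff verts_lex_blow_up card_image colour_lex_blow_up)
    moreover have "\<forall>x\<in>?S. f x = j" using v by auto
    ultimately show ?thesis by blast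
  next
    case False
    then obtain t where t: "t < a j" "\<And>v. v \<in> verts G \<Longrightarrow> f (prod_encode (t, v)) \<noteq> j" by blast
    then have "(\<lambda>v. f (prod_encode (t, v))) \<in> verts G \<rightarrow> J"
      using f by (fastforce simp: verts_lex_blow_up)
    then have "\<exists>i\<in>J. \<exists>S \<in> mono_cliques G (a i) i. \<forall>v\<in>S. f (prod_encode (t, v)) = i"
      using assms(1) unfolding arrows_def by (rule bspec[rotated])
    then obtain i S where i: "i \<in> J" and S: "S \<in> mono_cliques G (a i) i"
      "\<forall>v\<in>S. f (prod_encode (t, v)) = i" by blast
    let ?S = "(\<lambda>v. prod_encode (t, v)) ` S"
    have "inj_on (\<lambda>v. prod_encode (t, v)) S" by (auto simp: inj_on_def)
    then have "?S \<in> mono_cliques (lex_blow_up j (a j) G) (a i) i"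
      using S(1) t(1) by (auto simp: mono_cliques_iff verts_lex_blow_up card_image colour_lex_blow_up)
    moreover have "\<forall>x\<in>?S. f x = i" using S(2) by auto
    ultimately show ?thesis using i by blast
  qed
qed

text \<open>Each colour contributes one product, which multiplies the number of vertices by
  \<open>a j\<close> and preserves both clique-freeness and \<open>arrows\<close>.\<close>

lemma ex_arrows_clique_free:
  assumes "finite J"
  shows "\<exists>G. finite (verts G) \<and> card (verts G) = (\<Prod>i\<in>J. a i) \<and> colour G \<in> edges G \<rightarrow> J \<and>
    (\<forall>i\<in>J. mono_cliques G (Suc (a i)) i = {}) \<and> arrows J a G"
  using assms
proof (induction J)
  case empty
  have "edges ({0}, \<lambda>_. 0) = {}" by (auto simp: in_nsets_2_iff)
  \<comment> \<open>One vertex matches the empty product, and \<open>arrows\<close> holds vacuously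
    because a nonempty set has no map into the empty palette.\<close>
  then show ?case by (intro exI[of _ "({0}, \<lambda>_. 0)"]) (auto simp: arrows_def)
next
  case (insert j J)
  then obtain G where G: "finite (verts G)" "card (verts G) = (\<Prod>i\<in>J. a i)"
    "colour G \<in> edges G \<rightarrow> J" "\<And>i. i \<in> J \<Longrightarrow> mono_cliques G (Suc (a i)) i = {}" "arrows J a G"
    by blast
  show ?case
  proof (intro exI[of _ "lex_blow_up j (a j) G"] conjI ballI)
    show "finite (verts (lex_blow_up j (a j) G))" using G(1) by (simp add: verts_lex_blow_up)
    show "card (verts (lex_blow_up j (a j) G)) = (\<Prod>i\<in>insert j J. a i)"
      using insert.hyps G(2) by (simp add: card_verts_lex_blow_up)
    show "mono_cliques (lex_blow_up j (a j) G) (Suc (a i)) i = {}" if "i \<in> insert j J" for i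
      using that insert.hyps G mono_cliques_lex_blow_up_inner[of G "Suc (a i)" i j]
        mono_cliques_lex_blow_up_outer[OF G(3), of j "a j"] by (cases "i = j") auto
  qed (use insert.hyps G colour_lex_blow_up_in arrows_lex_blow_up in blast)+
qed

lemma ex_saturated:
  assumes "\<forall>i\<in>{1..c}. 1 \<le> k i"
  shows "\<exists>G. saturated c k G \<and> card (verts G) = (\<Prod>i = 1..c. k i - 1)"
proof -
  obtain G where G: "finite (verts G)" "card (verts G) = (\<Prod>i = 1..c. k i - 1)"
    "colour G \<in> edges G \<rightarrow> {1..c}" "\<forall>i\<in>{1..c}. mono_cliques G (Suc (k i - 1)) i = {}"
    "arrows {1..c} (\<lambda>i. k i - 1) G"
    using ex_arrows_clique_free[of "{1..c}" "\<lambda>i. k i - 1"] by auto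
  moreover have "Suc (k i - 1) = k i" if "i \<in> {1..c}" for i using assms that by force
  then have "\<forall>i\<in>{1..c}. mono_cliques G (k i) i = {}" using G(4) by metis
  ultimately show ?thesis
    using arrows_imp_saturated[of G c k] assms unfolding coloured_complete_graphs_def by blast
qed

section \<open>Combining the bounds on \<open>osat\<close> and \<open>sat\<close>\<close>

theorem theorem1:
  fixes c :: nat and k :: "nat \<Rightarrow> nat"
  assumes "c \<ge> 2" and "\<forall>i \<in> {1..c}. k i \<ge> 2"
  shows "(c = 2 \<longrightarrow> osat c k = sat c k \<and> sat c k = (k 1 - 1) * (k 2 - 1))
       \<and> (c \<ge> 3 \<longrightarrow>
            (int (k 1) - 1) * ((\<Sum>i = 2..c. int (k i)) - 2 * int c + 3) \<le> int (osat c k)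
          \<and> osat c k \<le> sat c k
          \<and> sat c k \<le> (\<Prod>i = 1..c. (k i - 1)))
       \<and> (\<forall>j \<in> {1..c}.
            (int (k j) - 1) * ((\<Sum>i \<in> {1..c} - {j}. int (k i)) - 2 * int c + 3)
              \<le> int (osat c k))"
proof -
  have k1: "\<forall>i\<in>{1..c}. 1 \<le> k i" using assms(2) by force
  obtain G where G: "saturated c k G" "card (verts G) = (\<Prod>i = 1..c. k i - 1)"
    using ex_saturated[OF k1] by blast
  have upper: "sat c k \<le> (\<Prod>i = 1..c. k i - 1)"
    unfolding sat_def G(2)[symmetric] using G(1) by (intro cInf_lower) blast+
  have mid: "osat c k \<le> sat c k"
    unfolding sat_def osat_def using G(1) saturated_imp_semisaturated
    by (intro cInf_superset_mono) (blast | simp)+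
  \<comment> \<open>The witness \<open>G\<close> is needed here too: over an empty set of
    semisaturated graphs the infimum would be 0.\<close>
  have lower_nat: "(k j - 1) * (1 + (\<Sum>i\<in>{1..c} - {j}. k i - 2)) \<le> osat c k"
    if "j \<in> {1..c}" for j
    unfolding osat_def
    using semisaturated_card_ge[OF _ assms(2) that] saturated_imp_semisaturated[OF G(1)]
    by (intro cInf_greatest) blast+
  have lower: "(int (k j) - 1) * ((\<Sum>i \<in> {1..c} - {j}. int (k i)) - 2 * int c + 3) \<le> int (osat c k)"
    if j: "j \<in> {1..c}" for j
  proof -
    \<comment> \<open>The truncated subtraction is exact since \<open>k i \<ge> 2\<close>. The
      \<open>c - 1\<close> summands contribute \<open>-2 * (c - 1)\<close>, which with the leading 1
      gives the constant \<open>3 - 2 * c\<close>.\<close>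
    have "int (\<Sum>i\<in>{1..c} - {j}. k i - 2) = (\<Sum>i\<in>{1..c} - {j}. int (k i) - 2)"
      unfolding of_nat_sum using assms(2) by (intro sum.cong) (auto simp: of_nat_diff)
    also have "\<dots> = (\<Sum>i\<in>{1..c} - {j}. int (k i)) - 2 * (int c - 1)"
      using j by (simp add: sum_subtractf of_nat_diff)
    finally have sum: "int (\<Sum>i\<in>{1..c} - {j}. k i - 2) = \<dots>" .
    have kj: "int (k j - 1) = int (k j) - 1" using bspec[OF k1 j] by simp
    have "int ((k j - 1) * (1 + (\<Sum>i\<in>{1..c} - {j}. k i - 2))) =
        (int (k j) - 1) * ((\<Sum>i \<in> {1..c} - {j}. int (k i)) - 2 * int c + 3)"
      unfolding of_nat_mult of_nat_add of_nat_1 kj sum by (simp add: algebra_simps)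
    then show ?thesis using lower_nat[OF j] by linarith
  qed
  \<comment> \<open>For two colours the sum has the single term \<open>k 2 - 2\<close>, so the lower
    bound equals the product.\<close>
  have "osat c k = sat c k \<and> sat c k = (k 1 - 1) * (k 2 - 1)" if "c = 2"
  proof -
    have c: "{1..c} = {1, 2}" using that by auto
    then have "{1..c} - {1} = {2}" by auto
    moreover have "1 + (k 2 - 2) = k 2 - 1" using assms(2) c by force
    ultimately have "(k 1 - 1) * (k 2 - 1) \<le> osat c k"
      using lower_nat[of 1] that by simp
    then show ?thesis using upper mid unfolding c by simp
  qed
  moreover have "{1..c} - {1} = {2..c}" by auto
  then have "(int (k 1) - 1) * ((\<Sum>i = 2..c. int (k i)) - 2 * int c + 3) \<le> int (osat c k)"
    using lower[of 1] assms(1) by simp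
  ultimately show ?thesis using mid upper lower by blast
qed

end
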